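(* Let the cells of the integer grid be colored by the chessboard coloring. For every positive integer $n$, the number of black-white balanced Dyck paths of semilength $n$ (with respect to the chessboard coloring) is $N(n,\lceil n/2\rceil)$, where $N(n,k)=\frac{1}{n}\binom{n}{k}\binom{n}{k-1}$. In particular, the proportion of black-white balanced Dyck paths among all Dyck paths of semilength $n$ is asymptotically $2/\sqrt{\pi n}$ as $n\to\infty$ (that is, the ratio of this proportion to $2/\sqrt{\pi n}$ tends to $1$).
   Context: For a positive integer $n$, a Dyck path of semilength $n$ is a lattice path from $(0,0)$ to $(n,n)$ consisting of $n$ right-steps $(1,0)$ and $n$ up-steps $(0,1)$ that never rises above the line $y=x$. The total number of Dyck paths of semilength $n$ is the Catalan number $C_n=\frac{1}{n+1}\binom{2n}{n}$. The cells of the integer grid are the unit squares; the $(i,j)$th cell ($i,j\ge 1$) is $[i-1,i]\times[j-1,j]$, lying in the $i$th column and $j$th row. In the chessboard coloring, the $(i,j)$th cell is black if $i+j$ is even and white otherwise. A cell lies below a Dyck path $p$ if it lies in the region between the $x$-axis and $p$; thus, in the $i$th column ($1\le i\le n$), the cells below $p$ are the $(i,1),\dots,(i,p_i)$th cells, where $p_i$ is the height ($y$-coordinate) of the $i$th right-step of $p$. Let $\mathrm{black}(p)$ and $\mathrm{white}(p)$ denote the numbers of black and white cells that lie below $p$. The path $p$ is called black-white balanced if $\mathrm{black}(p)=\mathrm{white}(p)$. The Narayana numbers are $N(n,k)=\frac{1}{n}\binom{n}{k}\binom{n}{k-1}$ for $1\le k\le n$. *)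

theory Defs
  imports Complex_Main
begin

text \<open>Lattice paths starting at the origin, as words of right-steps \<open>(1,0)\<close> and
  up-steps \<open>(0,1)\<close>. After its first \<open>k\<close> steps, a path \<open>p\<close> is at the point
  \<open>(xpos p k, ypos p k)\<close>.\<close>

datatype step = Right | Up

definition xpos :: "step list \<Rightarrow> nat \<Rightarrow> nat" where
  "xpos p k = count_list (take k p) Right"

definition ypos :: "step list \<Rightarrow> nat \<Rightarrow> nat" where
  "ypos p k = count_list (take k p) Up"

definition dyck_paths :: "nat \<Rightarrow> step list set" where
  "dyck_paths n =
    {p. count_list p Right = n \<and> count_list p Up = n \<and> (\<forall>k\<le>length p. ypos p k \<le> xpos p k)}"

text \<open>If \<open>p ! k\<close> is the \<open>i\<close>th right-step, then \<open>i = xpos p k + 1\<close>, and \<open>ypos p k\<close> is the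
  height \<open>p\<^sub>i\<close> of that step. Cells are numbered from 1 in both coordinates.\<close>

definition cells_below :: "step list \<Rightarrow> (nat \<times> nat) set" where
  "cells_below p =
    {(i, j). \<exists>k<length p. p ! k = Right \<and> i = xpos p k + 1 \<and> 1 \<le> j \<and> j \<le> ypos p k}"

definition black :: "step list \<Rightarrow> nat" where
  "black p = card {(i, j). (i, j) \<in> cells_below p \<and> even (i + j)}"

definition white :: "step list \<Rightarrow> nat" where
  "white p = card {(i, j). (i, j) \<in> cells_below p \<and> odd (i + j)}"

definition balanced_dyck_paths :: "nat \<Rightarrow> step list set" where
  "balanced_dyck_paths n = {p \<in> dyck_paths n. black p = white p}"

text \<open>Only meaningful for \<open>1 \<le> k \<le> n\<close>; the subtraction \<open>k - 1\<close> is on natural numbers.\<close>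

definition narayana :: "nat \<Rightarrow> nat \<Rightarrow> real" where
  "narayana n k = 1 / real n * real (n choose k) * real (n choose (k - 1))"

end

theory Submission
  imports Defs "HOL-Probability.Characteristic_Functions" "HOL-Real_Asymp.Real_Asymp"
begin

text \<open>
  The colors in a column alternate from the bottom cell up, so a column contributes to
  \<open>black p - white p\<close> only if its height is odd, and then it contributes
  \<open>1\<close> or \<open>-1\<close> according to the color of its bottom cell. Hence the difference
  depends only on the parities of the coordinates along the path. Modulo \<open>2\<close> the path is a
  walk on the \<open>4\<close>-cycle \<open>(0,0), (1,0), (1,1), (0,1)\<close>, and the steps that contribute are
  exactly the ones along the edge between \<open>(1,1)\<close> and \<open>(0,1)\<close>, counted with their direction. The
  net number of such steps can be read off the end of the walk lifted to the integers
  (\<open>black_minus_white_winding\<close>). The lifted walk moves forward at a right-step with even index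
  and at an up-step with odd index, and backward otherwise (indices start at \<open>0\<close>). On a Dyck path
  of semilength \<open>n\<close> with \<open>r\<close> right-steps at even indices there are also \<open>r\<close> up-steps at odd
  indices, so the lifted walk ends at \<open>2r - (2n - 2r) = 4r - 2n\<close>, and the path is balanced
  iff \<open>r = \<lceil>n / 2\<rceil>\<close> (\<open>balanced_iff_right_even\<close>).

  It remains to see that \<open>N(n, r)\<close> Dyck paths have \<open>r\<close> right-steps at even indices
  (\<open>card_dyck_paths_right_even\<close>). Such a path is coded by two words: one marks the right-steps
  among the even indices, the other marks the up-steps among the odd indices. That the path stays
  below the diagonal means that one word dominates the other, prefix by prefix, so that pairs of
  noncrossing lattice paths are counted. Their number is a \<open>2 \<times> 2\<close> determinant of binomial
  coefficients (\<open>card_odd_prefixes\<close>), which is a Narayana number. Summing over \<open>r\<close> with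
  Vandermonde's identity also yields the Catalan number (\<open>card_dyck_paths\<close>), and the asymptotics
  \<open>2m choose m \<sim> 4\<^sup>m / sqrt (\<pi> m)\<close>, which is Wallis's product, gives the proportion.
\<close>

section \<open>Right-steps at even indices and up-steps at odd indices\<close>

definition right_even :: "step list \<Rightarrow> nat" where
  "right_even p = card {k. k < length p \<and> even k \<and> p ! k = Right}"

definition up_odd :: "step list \<Rightarrow> nat" where
  "up_odd p = card {k. k < length p \<and> odd k \<and> p ! k = Up}"

lemma card_positions_snoc:
  "card {k. k < length (p @ [s]) \<and> P k ((p @ [s]) ! k)} =
   card {k. k < length p \<and> P k (p ! k)} + (if P (length p) s then 1 else 0)"
proof -
  have "{k. k < length (p @ [s]) \<and> P k ((p @ [s]) ! k)} =
        {k. k < length p \<and> P k (p ! k)} \<union> (if P (length p) s then {length p} else {})"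
    by (auto simp: nth_append less_Suc_eq split: if_splits)
  then show ?thesis by (auto simp: card_insert_if)
qed

lemma right_even_Nil [simp]: "right_even [] = 0"
  and up_odd_Nil [simp]: "up_odd [] = 0"
  by (simp_all add: right_even_def up_odd_def)

lemma right_even_snoc [simp]:
  "right_even (p @ [s]) = right_even p + (if even (length p) \<and> s = Right then 1 else 0)"
  using card_positions_snoc[of p s "\<lambda>k t. even k \<and> t = Right"] by (simp add: right_even_def)

lemma up_odd_snoc [simp]:
  "up_odd (p @ [s]) = up_odd p + (if odd (length p) \<and> s = Up then 1 else 0)"
  using card_positions_snoc[of p s "\<lambda>k t. odd k \<and> t = Up"] by (simp add: up_odd_def)

lemma length_eq_counts: "length p = count_list p Right + count_list p Up"
proof (induction p)
  case (Cons s p)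
  then show ?case by (cases s) auto
qed simp

text \<open>
  The right-steps at odd indices are the odd indices that carry no up-step. The number of odd
  indices is \<open>length p div 2\<close>; adding \<open>up_odd p\<close> on both sides avoids subtraction.
\<close>

lemma count_Right_plus_up_odd:
  "count_list p Right + up_odd p = right_even p + length p div 2"
proof (induction p rule: rev_induct)
  case (snoc s p)
  then show ?case by (cases s; cases "even (length p)") (auto elim!: evenE oddE)
qed simp

section \<open>Color difference as a winding number\<close>

lemma cells_below_snoc:
  "cells_below (p @ [s]) = cells_below p \<union>
     (if s = Right then {Suc (count_list p Right)} \<times> {1..count_list p Up} else {})"
proof -
  define Q where "Q q i j k \<longleftrightarrow> q ! k = Right \<and> i = xpos q k + 1 \<and> 1 \<le> j \<and> j \<le> ypos q k"
    for q i j k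
  have "Q (p @ [s]) i j k \<longleftrightarrow> Q p i j k" if "k < length p" for i j k
    using that by (simp add: Q_def nth_append xpos_def ypos_def)
  moreover have "Q (p @ [s]) i j (length p) \<longleftrightarrow>
      s = Right \<and> i = Suc (count_list p Right) \<and> 1 \<le> j \<and> j \<le> count_list p Up" for i j
    by (simp add: Q_def xpos_def ypos_def)
  ultimately have "(\<exists>k<length (p @ [s]). Q (p @ [s]) i j k) \<longleftrightarrow> (\<exists>k<length p. Q p i j k) \<or>
      (s = Right \<and> i = Suc (count_list p Right) \<and> 1 \<le> j \<and> j \<le> count_list p Up)" for i j
    unfolding length_append list.size add_0_right add_0 add_Suc_right less_Suc_eq by blast
  then show ?thesis
    unfolding cells_below_def Q_def[symmetric] by auto
qed

lemma cells_below_column_le: "(i, j) \<in> cells_below p \<Longrightarrow> i \<le> count_list p Right"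
proof (induction p rule: rev_induct)
  case Nil
  then show ?case by (simp add: cells_below_def)
next
  case (snoc s p)
  then show ?case by (auto simp: cells_below_snoc split: if_splits)
qed

lemma finite_cells_below: "finite (cells_below p)"
proof (induction p rule: rev_induct)
  case Nil
  then show ?case by (simp add: cells_below_def)
next
  case (snoc s p)
  then show ?case by (auto simp: cells_below_snoc)
qed

text \<open>
  Two neighbouring cells of a column have opposite colors, so in a column \<open>i\<close> of height \<open>h\<close> all
  cells cancel in pairs, up to the bottom cell \<open>(i, 1)\<close> if \<open>h\<close> is odd.
\<close>

lemma card_parity_initial:
  "int (card {j \<in> {1..h::nat}. even (i + j)}) - int (card {j \<in> {1..h}. odd (i + j)}) =
     (if odd h then (if odd i then 1 else -1) else 0)"
proof (induction h)
  case (Suc h)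
  have split: "{j \<in> {1..Suc h}. P (i + j)} =
      {j \<in> {1..h}. P (i + j)} \<union> (if P (i + Suc h) then {Suc h} else {})" for P
    by (auto simp: le_Suc_eq)
  have "card {j \<in> {1..Suc h}. P (i + j)} =
      card {j \<in> {1..h}. P (i + j)} + (if P (i + Suc h) then 1 else 0)" for P
    by (subst split) auto
  from this[of even] this[of odd] show ?case
    using Suc unfolding of_nat_add by (auto simp del: atLeastAtMost_iff split: if_splits)
qed simp

lemma black_minus_white_snoc:
  "int (black (p @ [s])) - int (white (p @ [s])) = int (black p) - int (white p) +
     (if s = Right \<and> odd (count_list p Up) then (if even (count_list p Right) then 1 else -1) else 0)"
proof (cases s)
  case Up
  then show ?thesis by (simp add: black_def white_def cells_below_snoc)
next
  case Right
  define x where "x = count_list p Right"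
  define h where "h = count_list p Up"
  have card_new: "card {(i, j). (i, j) \<in> cells_below (p @ [s]) \<and> P (i + j)} =
      card {(i, j). (i, j) \<in> cells_below p \<and> P (i + j)} + card {j \<in> {1..h}. P (Suc x + j)}" for P
  proof -
    have "{(i, j). (i, j) \<in> cells_below (p @ [s]) \<and> P (i + j)} =
        {(i, j). (i, j) \<in> cells_below p \<and> P (i + j)} \<union> Pair (Suc x) ` {j \<in> {1..h}. P (Suc x + j)}"
      using Right by (auto simp: cells_below_snoc x_def h_def)
    moreover have "{(i, j). (i, j) \<in> cells_below p \<and> P (i + j)} \<inter>
        Pair (Suc x) ` {j \<in> {1..h}. P (Suc x + j)} = {}"
      using cells_below_column_le[of "Suc x" _ p] by (auto simp: x_def)
    moreover have "finite {(i, j). (i, j) \<in> cells_below p \<and> P (i + j)}"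
      by (rule finite_subset[OF _ finite_cells_below[of p]]) auto
    ultimately show ?thesis by (simp add: card_Un_disjoint card_image inj_on_def)
  qed
  show ?thesis
    using card_parity_initial[of h "Suc x"] card_new[of even] card_new[of odd] Right
    by (auto simp: black_def white_def x_def h_def split: if_splits)
qed

text \<open>
  The end of the walk lifted from the \<open>4\<close>-cycle \<open>(0,0), (1,0), (1,1), (0,1)\<close> to the integers:
  the number of forward steps minus the number of backward steps. The residues \<open>0, 1, 2, 3\<close>
  modulo \<open>4\<close> stand for these four corners in this order.
\<close>

definition winding :: "step list \<Rightarrow> int" where
  "winding p = 2 * (int (right_even p) + int (up_odd p)) - int (length p)"

lemma winding_snoc:
  "winding (p @ [s]) = winding p + (if (s = Right) = even (length p) then 1 else -1)"
  by (cases s) (auto simp: winding_def)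

text \<open>
  The top of a column of odd height with a black bottom cell is a step from the corner \<open>(0,1)\<close> back
  to \<open>(1,1)\<close>, that is, from residue \<open>3\<close> to residue \<open>2\<close>; with a white bottom cell it is the reverse
  step. The quotient
  \<open>(winding p + 1) div 4\<close> changes at precisely these steps, by \<open>-1\<close> and \<open>1\<close>. The two parity claims
  identify the current corner and are needed to carry the induction.
\<close>

lemma black_minus_white_winding:
  "int (black p) - int (white p) = - ((winding p + 1) div 4) \<and>
   (even (count_list p Right) \<longleftrightarrow> winding p mod 4 \<in> {0, 3}) \<and>
   (even (count_list p Up) \<longleftrightarrow> winding p mod 4 \<in> {0, 1})"
proof (induction p rule: rev_induct)
  case Nil
  then show ?case by (simp add: black_def white_def cells_below_def winding_def)
next
  case (snoc s p)
  define r where "r = winding p mod 4"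
  define d where "d = int (black p) - int (white p)"
  define fwd where "fwd \<longleftrightarrow> (s = Right) = even (length p)"
  have IH: "d = - ((winding p + 1) div 4)"
      "even (count_list p Right) \<longleftrightarrow> r = 0 \<or> r = 3"
      "even (count_list p Up) \<longleftrightarrow> r = 0 \<or> r = 1"
    using snoc by (auto simp: d_def r_def)
  have r: "r = 0 \<or> r = 1 \<or> r = 2 \<or> r = 3" unfolding r_def by presburger
  \<comment> \<open>The parity of the index of the new step decides whether that step moves forward.\<close>
  have len: "even (length p) \<longleftrightarrow> r = 0 \<or> r = 2"
    using IH(2,3) r by (auto simp: length_eq_counts[of p])
  have shift_mod: "(t + 1) mod 4 = (if t mod 4 = 3 then 0 else t mod 4 + 1)"
      "(t + -1) mod 4 = (if t mod 4 = 0 then 3 else t mod 4 - 1)" for t :: int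
    by presburger+
  have shift_div: "(t + 1 + 1) div 4 = (t + 1) div 4 + (if t mod 4 = 2 then 1 else 0)"
      "(t + -1 + 1) div 4 = (t + 1) div 4 + (if t mod 4 = 3 then -1 else 0)" for t :: int
    by presburger+
  have new_mod: "winding (p @ [s]) mod 4 =
      (if fwd then (if r = 3 then 0 else r + 1) else (if r = 0 then 3 else r - 1))"
    unfolding winding_snoc fwd_def[symmetric] r_def by (simp only: shift_mod split: if_split) simp
  have new_div: "(winding (p @ [s]) + 1) div 4 = (winding p + 1) div 4 +
      (if fwd then (if r = 2 then 1 else 0) else (if r = 3 then -1 else 0))"
    unfolding winding_snoc fwd_def[symmetric] r_def by (simp only: shift_div split: if_split) simp
  show ?case
    unfolding black_minus_white_snoc d_def[symmetric] new_mod new_div IH(1)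
    using r len IH(2,3) by (cases s) (auto simp: fwd_def)
qed

section \<open>Counting Dyck paths by right-steps at even indices\<close>

definition below_diagonal :: "step list \<Rightarrow> bool" where
  "below_diagonal p \<longleftrightarrow> (\<forall>k\<le>length p. ypos p k \<le> xpos p k)"

lemma below_diagonal_Nil: "below_diagonal []"
  by (simp add: below_diagonal_def xpos_def ypos_def)

lemma below_diagonal_snoc:
  "below_diagonal (p @ [s]) \<longleftrightarrow> below_diagonal p \<and> count_list (p @ [s]) Up \<le> count_list (p @ [s]) Right"
proof -
  have "ypos (p @ [s]) k = ypos p k" "xpos (p @ [s]) k = xpos p k" if "k \<le> length p" for k
    using that by (simp_all add: xpos_def ypos_def)
  moreover have "ypos (p @ [s]) (Suc (length p)) = count_list (p @ [s]) Up"
      "xpos (p @ [s]) (Suc (length p)) = count_list (p @ [s]) Right"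
    by (simp_all add: xpos_def ypos_def)
  ultimately show ?thesis
    unfolding below_diagonal_def length_append list.size add_0_right add_0 add_Suc_right le_Suc_eq by auto
qed

lemma below_diagonal_imp_Up_le_Right: "below_diagonal p \<Longrightarrow> count_list p Up \<le> count_list p Right"
  by (cases p rule: rev_cases) (auto simp: below_diagonal_snoc)

lemma dyck_paths_altdef:
  "dyck_paths n = {p. count_list p Right = n \<and> count_list p Up = n \<and> below_diagonal p}"
  by (simp add: dyck_paths_def below_diagonal_def)

text \<open>
  The words have odd length because after an odd number of steps the difference between the two
  coordinates is odd. On an admissible word it is at least \<open>1\<close>, and one more step of either kind
  is then admissible. The
  parameters are integers so that \<open>a - 1\<close> and \<open>b - 1\<close> below simply give an empty set at the
  boundary.
\<close>

definition odd_prefixes :: "nat \<Rightarrow> int \<Rightarrow> int \<Rightarrow> step list set" where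
  "odd_prefixes m a b =
     {p. length p = 2 * m + 1 \<and> below_diagonal p \<and> int (right_even p) = a \<and> int (up_odd p) = b}"

lemma odd_length_height:
  assumes "length p = 2 * m + 1"
  shows "int (count_list p Right) - int (count_list p Up) = 2 * (int (right_even p) - int (up_odd p)) - 1"
proof -
  have "count_list p Right + up_odd p = right_even p + m"
    using count_Right_plus_up_odd[of p] assms by simp
  moreover have "count_list p Right + count_list p Up = 2 * m + 1"
    using length_eq_counts[of p] assms by simp
  ultimately show ?thesis by presburger
qed

text \<open>
  For \<open>b = a\<close> the path would end one step above the diagonal. This is the boundary condition of the
  recurrence that counts these words.
\<close>

lemma odd_prefixes_diagonal: "odd_prefixes m a a = {}"
  using odd_length_height below_diagonal_imp_Up_le_Right by (fastforce simp: odd_prefixes_def)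

lemma finite_odd_prefixes: "finite (odd_prefixes m a b)"
proof -
  have "(UNIV :: step set) = {Right, Up}"
    using step.exhaust by auto
  then have "finite (UNIV :: step set)"
    by (metis finite.emptyI finite.insertI)
  from finite_lists_length_eq[OF this, of "2 * m + 1"] show ?thesis
    by (rule finite_subset[rotated]) (auto simp: odd_prefixes_def)
qed

text \<open>
  A single step after \<open>p\<close> cannot cross the diagonal, since \<open>x - y\<close> is odd at the end of \<open>p\<close> and
  hence at least \<open>1\<close>. After the second step \<open>x - y\<close> is determined by the two counts. So the
  condition for two more steps needs to be tested at the end only.
\<close>

lemma below_diagonal_snoc2_odd:
  assumes len: "length p = 2 * m + 1"
    and above: "right_even (p @ [s, t]) > up_odd (p @ [s, t])"
  shows "below_diagonal (p @ [s, t]) \<longleftrightarrow> below_diagonal p"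
proof
  assume "below_diagonal (p @ [s, t])"
  then have "below_diagonal ((p @ [s]) @ [t])" by simp
  then show "below_diagonal p" unfolding below_diagonal_snoc by blast
next
  assume "below_diagonal p"
  then have "count_list p Up \<le> count_list p Right"
    by (rule below_diagonal_imp_Up_le_Right)
  moreover have "count_list p Up \<noteq> count_list p Right"
    using odd_length_height[OF len] by presburger
  ultimately have "below_diagonal (p @ [s])"
    using \<open>below_diagonal p\<close> by (cases s) (auto simp: below_diagonal_snoc)
  moreover have "count_list (p @ [s, t]) Up \<le> count_list (p @ [s, t]) Right"
    using odd_length_height[of "p @ [s, t]" "Suc m"] len above by simp
  ultimately have "below_diagonal ((p @ [s]) @ [t])" unfolding below_diagonal_snoc[of "p @ [s]" t] by simp
  then show "below_diagonal (p @ [s, t])" by simp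
qed

lemma right_even_snoc2 [simp]:
  "odd (length p) \<Longrightarrow> right_even (p @ [s, t]) = right_even p + (if t = Right then 1 else 0)"
  and up_odd_snoc2 [simp]:
  "odd (length p) \<Longrightarrow> up_odd (p @ [s, t]) = up_odd p + (if s = Up then 1 else 0)"
  using right_even_snoc[of "p @ [s]" t] up_odd_snoc[of "p @ [s]" t] by simp_all

text \<open>
  The last two steps are free: the first of them has an odd index and the second an even one, so
  each of the four choices lowers \<open>a\<close> and \<open>b\<close> independently by \<open>0\<close> or \<open>1\<close>.
\<close>

lemma odd_prefixes_Suc:
  assumes "b < a"
  shows "odd_prefixes (Suc m) a b =
    (\<lambda>p. p @ [Right, Up]) ` odd_prefixes m a b \<union> (\<lambda>p. p @ [Right, Right]) ` odd_prefixes m (a - 1) b \<union>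
    (\<lambda>p. p @ [Up, Up]) ` odd_prefixes m a (b - 1) \<union> (\<lambda>p. p @ [Up, Right]) ` odd_prefixes m (a - 1) (b - 1)"
    (is "_ = ?U")
proof (intro equalityI subsetI)
  fix w assume w: "w \<in> odd_prefixes (Suc m) a b"
  then have len_w: "length w = Suc (Suc (2 * m + 1))" by (simp add: odd_prefixes_def)
  then obtain q t where "w = q @ [t]" by (metis length_Suc_conv_rev)
  moreover from this len_w obtain p s where "q = p @ [s]" by (metis length_Suc_conv_rev length_append_singleton nat.inject)
  ultimately have w_eq: "w = p @ [s, t]" by simp
  have len: "length p = 2 * m + 1" using len_w w_eq by simp
  have "up_odd w < right_even w" using w assms by (simp add: odd_prefixes_def)
  with w have "below_diagonal p" using below_diagonal_snoc2_odd[OF len] unfolding w_eq odd_prefixes_def by blast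
  then show "w \<in> ?U"
    using w len unfolding w_eq by (cases s; cases t) (auto simp: odd_prefixes_def)
next
  fix w assume "w \<in> ?U"
  then obtain p s t where w_eq: "w = p @ [s, t]" and len: "length p = 2 * m + 1" and "below_diagonal p"
    and ab: "int (right_even w) = a" "int (up_odd w) = b"
    by (auto simp: odd_prefixes_def)
  moreover have "below_diagonal w"
    using below_diagonal_snoc2_odd[OF len, of s t] ab assms \<open>below_diagonal p\<close> unfolding w_eq by simp
  ultimately show "w \<in> odd_prefixes (Suc m) a b" by (simp add: odd_prefixes_def)
qed

text \<open>
  Binomial coefficients extended by zero to negative lower index. With this extension Pascal's rule
  holds for every integer, so the recurrence needs no case distinction at the boundary.
\<close>

definition ibinom :: "nat \<Rightarrow> int \<Rightarrow> int" where
  "ibinom m j = (if j < 0 then 0 else int (m choose nat j))"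

lemma ibinom_Suc: "ibinom (Suc m) j = ibinom m j + ibinom m (j - 1)"
proof (cases "j \<le> 0")
  case False
  then obtain i where "j = int (Suc i)" by (metis not_less pos_int_cases not_le Suc_pred)
  then show ?thesis by (simp add: ibinom_def nat_add_distrib)
qed (auto simp: ibinom_def)

text \<open>
  This is the determinant for two noncrossing lattice paths. By Pascal's rule each of its two
  products satisfies the four-term recurrence of \<open>odd_prefixes_Suc\<close>, and for \<open>b = a\<close> the
  products cancel, in agreement with \<open>odd_prefixes_diagonal\<close>. The case \<open>b = a\<close> has to be
  included because the terms with \<open>a - 1\<close> and \<open>b\<close> reach it.
\<close>

lemma card_odd_prefixes:
  "b \<le> a \<Longrightarrow> int (card (odd_prefixes m a b)) =
     ibinom m (a - 1) * ibinom m b - ibinom m a * ibinom m (b - 1)"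
proof (induction m arbitrary: a b)
  case 0
  have "odd_prefixes 0 a b = (if a = 1 \<and> b = 0 then {[Right]} else {})"
  proof -
    have "p \<in> odd_prefixes 0 a b \<longleftrightarrow> p = [Right] \<and> a = 1 \<and> b = 0" for p
    proof (cases "length p = 1")
      case True
      then obtain s where "p = [] @ [s]" by (auto simp: length_Suc_conv)
      moreover have "right_even [s] = (if s = Right then 1 else 0)" "up_odd [s] = 0" "below_diagonal [s] \<longleftrightarrow> s = Right"
        using right_even_snoc[of "[]" s] up_odd_snoc[of "[]" s] below_diagonal_snoc[of "[]" s]
        by (cases s; simp add: below_diagonal_Nil)+
      ultimately show ?thesis by (auto simp: odd_prefixes_def)
    qed (auto simp: odd_prefixes_def)
    then show ?thesis by auto
  qed
  moreover have "ibinom 0 j = (if j = 0 then 1 else 0)" for j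
    by (auto simp: ibinom_def binomial_eq_0_iff)
  ultimately show ?case using 0 by auto
next
  case (Suc m)
  show ?case
  proof (cases "b = a")
    case True
    then show ?thesis by (simp add: odd_prefixes_diagonal)
  next
    case False
    with Suc.prems have "b < a" by simp
    have "card (odd_prefixes (Suc m) a b) =
        card (odd_prefixes m a b) + card (odd_prefixes m (a - 1) b) +
        card (odd_prefixes m a (b - 1)) + card (odd_prefixes m (a - 1) (b - 1))"
      unfolding odd_prefixes_Suc[OF \<open>b < a\<close>]
      by (subst card_Un_disjoint; (force simp: finite_odd_prefixes)?)+
        (simp add: card_image inj_on_def)
    then show ?thesis
      using \<open>b < a\<close> Suc.IH[of b a] Suc.IH[of b "a - 1"] Suc.IH[of "b - 1" a]
        Suc.IH[of "b - 1" "a - 1"]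
      by (simp add: ibinom_Suc algebra_simps)
  qed
qed


text \<open>
  A nonempty Dyck path ends with an up-step at an odd index. Without it, one of the \<open>r\<close> up-steps
  at odd indices is lost and a word of odd length remains.
\<close>

lemma dyck_paths_right_even_eq_image:
  "{p \<in> dyck_paths (Suc m). right_even p = r} =
     (\<lambda>p. p @ [Up]) ` odd_prefixes m (int r) (int r - 1)"
proof (intro equalityI subsetI)
  fix w assume "w \<in> {p \<in> dyck_paths (Suc m). right_even p = r}"
  then have w: "count_list w Right = Suc m" "count_list w Up = Suc m" "below_diagonal w" "right_even w = r"
    by (auto simp: dyck_paths_altdef)
  have "w \<noteq> []" using w(1) by auto
  then obtain p s where w_eq: "w = p @ [s]" by (metis rev_exhaust)
  have "below_diagonal p" using w(3) unfolding w_eq below_diagonal_snoc by simp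
  have "s = Up"
    using w(1,2) below_diagonal_imp_Up_le_Right[OF \<open>below_diagonal p\<close>] unfolding w_eq by (cases s) auto
  have len: "length p = 2 * m + 1"
    using w(1,2) length_eq_counts[of w] unfolding w_eq by simp
  have "right_even p = r" using w(4) \<open>s = Up\<close> unfolding w_eq by simp
  moreover have "int (up_odd p) = int r - 1"
    using odd_length_height[OF len] w(1,2) \<open>s = Up\<close> \<open>right_even p = r\<close> unfolding w_eq by simp
  ultimately have "p \<in> odd_prefixes m (int r) (int r - 1)"
    using \<open>below_diagonal p\<close> len by (simp add: odd_prefixes_def)
  then show "w \<in> (\<lambda>p. p @ [Up]) ` odd_prefixes m (int r) (int r - 1)"
    unfolding w_eq \<open>s = Up\<close> by blast
next
  fix w assume "w \<in> (\<lambda>p. p @ [Up]) ` odd_prefixes m (int r) (int r - 1)"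
  then obtain p where w_eq: "w = p @ [Up]" and len: "length p = 2 * m + 1" and "below_diagonal p"
    and r: "right_even p = r" "int (up_odd p) = int r - 1"
    by (auto simp: odd_prefixes_def)
  have "int (count_list p Right) - int (count_list p Up) = 1"
    using odd_length_height[OF len] r by simp
  then have "count_list p Right = Suc m" "count_list p Up = m"
    using length_eq_counts[of p] len by presburger+
  then show "w \<in> {p \<in> dyck_paths (Suc m). right_even p = r}"
    using \<open>below_diagonal p\<close> r(1) len unfolding w_eq by (simp add: dyck_paths_altdef below_diagonal_snoc)
qed

lemma binomial_ratio: "Suc k * (n choose Suc k) = (n - k) * (n choose k)"
  by (simp only: binomial_absorption binomial_absorb_comp)

text \<open>
  With consecutive coefficients \<open>A, B, C\<close> of row \<open>m\<close>, both sides become multiples of \<open>B\<close> once \<open>C\<close>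
  is eliminated with the ratio \<open>C / B\<close>; the remaining linear identity is the ratio \<open>B / A\<close>.
\<close>

lemma narayana_determinant:
  "int (Suc m) * (ibinom m (int j) * ibinom m (int j) - ibinom m (int (Suc j)) * ibinom m (int j - 1)) =
   int (Suc m choose Suc j) * int (Suc m choose j)"
proof (cases j)
  case 0
  then show ?thesis by (simp add: ibinom_def)
next
  case (Suc i)
  define A B C where "A = int (m choose i)" and "B = int (m choose Suc i)"
    and "C = int (m choose Suc (Suc i))"
  have pascal: "int (Suc m choose Suc j) = C + B" "int (Suc m choose j) = B + A"
    by (simp_all add: A_def B_def C_def Suc)
  have absorb: "int (Suc k) * int (m choose Suc k) = (int m - int k) * int (m choose k)" for k
  proof (cases "k \<le> m")
    case True
    then have "(int m - int k) * int (m choose k) = int ((m - k) * (m choose k))"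
      by (simp add: of_nat_diff)
    then show ?thesis by (simp only: flip: of_nat_mult binomial_ratio)
  qed (simp add: binomial_eq_0)
  have "(int i + 1) * B = (int m - int i) * A" "(int i + 2) * C = (int m - int i - 1) * B"
    using absorb[of i] absorb[of "Suc i"] by (simp_all add: A_def B_def C_def algebra_simps)
  note ratios = this
  \<comment> \<open>The factor \<open>i + 2\<close> is the denominator of \<open>C / B\<close>.\<close>
  have "(int i + 2) * (int (Suc m) * (B * B - C * A)) =
      int (Suc m) * (B * ((int i + 2) * B) - ((int i + 2) * C) * A)"
    by (simp only: algebra_simps)
  also have "\<dots> = int (Suc m) * B * ((int i + 1) * B + B - (int m - int i - 1) * A)"
    unfolding ratios(2) by (simp add: algebra_simps)
  also have "\<dots> = int (Suc m) * B * (B + A)"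
    unfolding ratios(1) by (simp add: algebra_simps)
  also have "\<dots> = ((int m - int i - 1) * B + (int i + 2) * B) * (B + A)"
    by (simp add: algebra_simps)
  also have "\<dots> = (int i + 2) * ((C + B) * (B + A))"
    unfolding ratios(2)[symmetric] by (simp only: algebra_simps)
  finally have "(int i + 2) * (int (Suc m) * (B * B - C * A)) = (int i + 2) * ((C + B) * (B + A))" .
  then have "int (Suc m) * (B * B - C * A) = (C + B) * (B + A)" by simp
  moreover have "ibinom m (int j) = B" "ibinom m (int (Suc j)) = C" "ibinom m (int j - 1) = A"
    by (simp_all add: ibinom_def A_def B_def C_def Suc nat_add_distrib)
  ultimately show ?thesis unfolding pascal by simp
qed

lemma card_dyck_paths_right_even:
  assumes "r \<ge> 1"
  shows "real (card {p \<in> dyck_paths (Suc m). right_even p = r}) = narayana (Suc m) r"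
proof -
  obtain j where r: "r = Suc j" using assms by (cases r) auto
  have "int (card {p \<in> dyck_paths (Suc m). right_even p = r}) =
      ibinom m (int j) * ibinom m (int j) - ibinom m (int (Suc j)) * ibinom m (int j - 1)"
    unfolding dyck_paths_right_even_eq_image
    by (subst card_image) (simp_all add: card_odd_prefixes inj_on_def r)
  then have "int (Suc m) * int (card {p \<in> dyck_paths (Suc m). right_even p = r}) =
      int (Suc m choose r) * int (Suc m choose j)"
    using narayana_determinant[of m j] r by simp
  then have "real (Suc m) * real (card {p \<in> dyck_paths (Suc m). right_even p = r}) =
      real (Suc m choose r) * real (Suc m choose j)"
    by (simp only: flip: of_nat_mult)
  then show ?thesis
    by (simp add: narayana_def r eq_divide_eq mult.commute del: of_nat_Suc binomial_Suc_Suc)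
qed

text \<open>
  Balance means that \<open>winding p = 4r - 2n\<close> lies between \<open>-1\<close> and \<open>2\<close>, so that
  \<open>r - n/2\<close> is \<open>0\<close> or \<open>1/2\<close>; the parity of \<open>n\<close> leaves one of the two.
\<close>

lemma balanced_iff_right_even:
  assumes "p \<in> dyck_paths n"
  shows "black p = white p \<longleftrightarrow> right_even p = (n + 1) div 2"
proof -
  have p: "count_list p Right = n" "count_list p Up = n"
    using assms by (auto simp: dyck_paths_altdef)
  then have len: "length p = 2 * n" by (simp add: length_eq_counts)
  then have "winding p = 4 * int (right_even p) - 2 * int n"
    using count_Right_plus_up_odd[of p] p by (simp add: winding_def)
  then have "black p = white p \<longleftrightarrow> (4 * int (right_even p) - 2 * int n + 1) div 4 = 0"
    using black_minus_white_winding[of p] by auto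
  also have "\<dots> \<longleftrightarrow> right_even p = (n + 1) div 2" by presburger
  finally show ?thesis .
qed

lemma nat_ceiling_half: "nat \<lceil>real n / 2\<rceil> = (n + 1) div 2"
proof -
  have "\<lceil>real n / 2\<rceil> = int ((n + 1) div 2)"
    by (rule ceiling_unique) (auto simp: field_simps; linarith)+
  then show ?thesis by simp
qed

lemma card_balanced_dyck_paths:
  assumes "n \<ge> 1"
  shows "real (card (balanced_dyck_paths n)) = narayana n ((n + 1) div 2)"
proof -
  obtain m where n: "n = Suc m" using assms by (cases n) auto
  have "balanced_dyck_paths n = {p \<in> dyck_paths n. right_even p = (n + 1) div 2}"
    using balanced_iff_right_even by (auto simp: balanced_dyck_paths_def)
  then show ?thesis
    using card_dyck_paths_right_even[of "(n + 1) div 2" m] unfolding n by simp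
qed

section \<open>The number of all Dyck paths\<close>

lemma right_even_bounds:
  assumes "p \<in> dyck_paths (Suc m)"
  shows "right_even p \<in> {1..Suc m}"
proof -
  have "right_even q \<le> count_list q Right" for q
    by (induction q rule: rev_induct) auto
  from this[of p] have "right_even p \<le> Suc m"
    using assms by (simp add: dyck_paths_altdef)
  moreover have "right_even p \<noteq> 0"
    using dyck_paths_right_even_eq_image[of m 0] assms by (auto simp: odd_prefixes_def)
  ultimately show ?thesis by simp
qed

lemma finite_dyck_paths_fiber: "finite {p \<in> dyck_paths (Suc m). right_even p = r}"
  unfolding dyck_paths_right_even_eq_image by (simp add: finite_odd_prefixes)

text \<open>
  Every Dyck path has some number \<open>r\<close> of right-steps at even indices, so the Catalan number is the
  sum of the Narayana numbers, which Vandermonde's identity evaluates.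
\<close>

lemma card_dyck_paths:
  "real (card (dyck_paths n)) = real ((2 * n) choose n) / real (n + 1)"
proof (cases n)
  case 0
  have "dyck_paths 0 = {[]}"
    by (auto simp: dyck_paths_altdef below_diagonal_Nil length_0_conv[symmetric] length_eq_counts simp del: length_0_conv)
  then show ?thesis using 0 by simp
next
  case (Suc m)
  have union: "dyck_paths n = (\<Union>r\<in>{1..n}. {p \<in> dyck_paths n. right_even p = r})"
    using right_even_bounds unfolding Suc by blast
  have "card (dyck_paths n) = (\<Sum>r\<in>{1..n}. card {p \<in> dyck_paths n. right_even p = r})"
    by (subst union, rule card_UN_disjoint) (auto simp: Suc finite_dyck_paths_fiber)
  then have "real (card (dyck_paths n)) = (\<Sum>r\<in>{1..n}. narayana n r)"
    unfolding Suc by (simp add: card_dyck_paths_right_even)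
  also have "\<dots> = (\<Sum>j\<le>m. narayana n (Suc j))"
    unfolding Suc by (rule sum.reindex_bij_witness[of _ Suc "\<lambda>r. r - 1"]) auto
  also have "\<dots> = real (\<Sum>j\<le>m. (n choose j) * (n choose (m - j))) / real n"
    unfolding of_nat_sum sum_divide_distrib
  proof (rule sum.cong[OF refl])
    fix j assume "j \<in> {..m}"
    then have "n choose (m - j) = n choose Suc j"
      using binomial_symmetric[of "Suc j" n] Suc by simp
    then show "narayana n (Suc j) = real ((n choose j) * (n choose (m - j))) / real n"
      by (simp add: narayana_def)
  qed
  also have "\<dots> = real ((2 * n) choose m) / real n"
    using vandermonde[of n n m] by (simp add: mult_2)
  also have "\<dots> = real ((2 * n) choose n) / real (n + 1)"
  proof -
    have "n * ((2 * n) choose n) = (n + 1) * ((2 * n) choose m)"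
      using binomial_ratio[of m "2 * n"] Suc by simp
    then have "real n * real ((2 * n) choose n) = real (n + 1) * real ((2 * n) choose m)"
      by (simp only: flip: of_nat_mult)
    then show ?thesis using Suc by (simp add: field_simps)
  qed
  finally show ?thesis .
qed

section \<open>Asymptotics of the proportion\<close>

text \<open>
  The central binomial coefficient divided by its asymptotic value \<open>4\<^sup>m / sqrt (\<pi> m)\<close>.
\<close>

definition central_ratio :: "nat \<Rightarrow> real" where
  "central_ratio m = real ((2 * m) choose m) / 4 ^ m * sqrt (pi * real m)"

lemma odd_binomial_central:
  "real (m + 1) * real ((2 * m + 1) choose m) = real (2 * m + 1) * real ((2 * m) choose m)"
  "real (m + 1) * real ((2 * m + 1) choose (m + 1)) = real (2 * m + 1) * real ((2 * m) choose m)"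
proof -
  have "Suc m * (Suc (2 * m) choose Suc m) = Suc (2 * m) * ((2 * m) choose m)"
    by (rule Suc_times_binomial)
  moreover have "Suc (2 * m) choose Suc m = Suc (2 * m) choose m"
    using binomial_symmetric[of m "Suc (2 * m)"] by (simp add: Suc_diff_le del: binomial_Suc_Suc)
  ultimately show "real (m + 1) * real ((2 * m + 1) choose m) = real (2 * m + 1) * real ((2 * m) choose m)"
    "real (m + 1) * real ((2 * m + 1) choose (m + 1)) = real (2 * m + 1) * real ((2 * m) choose m)"
    by (simp_all only: Suc_eq_plus1 flip: of_nat_mult)
qed

lemma central_binomial_Suc:
  "real (m + 1) * real ((2 * Suc m) choose Suc m) = 2 * real (2 * m + 1) * real ((2 * m) choose m)"
proof -
  have "(2 * Suc m) choose Suc m = ((2 * m + 1) choose m) + ((2 * m + 1) choose (m + 1))"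
    by simp
  then show ?thesis
    using odd_binomial_central[of m] by (simp del: binomial_Suc_Suc add: algebra_simps)
qed

lemma wallis_product_eq:
  "(\<Prod>k=1..m. (4 * real k ^ 2) / (4 * real k ^ 2 - 1)) =
     1 / ((real ((2 * m) choose m) / 4 ^ m) ^ 2 * real (2 * m + 1))"
proof (induction m)
  case (Suc m)
  define B where "B = real ((2 * m) choose m)"
  have "B > 0" by (simp add: B_def)
  have B_Suc: "real ((2 * Suc m) choose Suc m) = 2 * real (2 * m + 1) * B / real (m + 1)"
    using central_binomial_Suc[of m] by (simp add: B_def field_simps del: binomial_Suc_Suc)
  have factor: "4 * real (Suc m) ^ 2 - 1 = real (2 * m + 1) * real (2 * Suc m + 1)"
    by (simp add: power2_eq_square algebra_simps)
  have "(\<Prod>k=1..Suc m. (4 * real k ^ 2) / (4 * real k ^ 2 - 1)) =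
      1 / ((B / 4 ^ m) ^ 2 * real (2 * m + 1)) *
      (4 * real (m + 1) ^ 2 / (real (2 * m + 1) * real (2 * Suc m + 1)))"
    using Suc unfolding factor[symmetric] by (simp add: B_def)
  also have "\<dots> = 1 / ((2 * real (2 * m + 1) * B / real (m + 1) / 4 ^ Suc m) ^ 2 * real (2 * Suc m + 1))"
    using \<open>B > 0\<close> by (simp add: divide_simps del: of_nat_Suc of_nat_add of_nat_mult) (simp add: power2_eq_square)
  finally show ?case unfolding B_Suc .
qed simp

text \<open>
  The square of \<open>central_ratio m\<close> is \<open>\<pi> m / (2m + 1)\<close> divided by the partial Wallis product, which
  tends to \<open>(\<pi> / 2) / (\<pi> / 2)\<close>.
\<close>

lemma central_ratio_tendsto_1: "central_ratio \<longlonglongrightarrow> 1"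
proof -
  define W where "W m = (\<Prod>k=1..m. (4 * real k ^ 2) / (4 * real k ^ 2 - 1))" for m
  have "W \<longlonglongrightarrow> pi / 2" unfolding W_def using wallis .
  moreover have "(\<lambda>m. pi * (real m / real (2 * m + 1))) \<longlonglongrightarrow> pi * (1 / 2)" by real_asymp
  ultimately have "(\<lambda>m. sqrt (pi * (real m / real (2 * m + 1)) / W m)) \<longlonglongrightarrow> sqrt (pi * (1 / 2) / (pi / 2))"
    by (intro tendsto_real_sqrt tendsto_divide) auto
  moreover have "sqrt (pi * (real m / real (2 * m + 1)) / W m) = central_ratio m" for m
  proof -
    have "pi * (real m / real (2 * m + 1)) / W m =
        (real ((2 * m) choose m) / 4 ^ m) ^ 2 * (pi * real m)"
      unfolding W_def wallis_product_eq by simp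
    then show ?thesis by (simp add: central_ratio_def real_sqrt_mult)
  qed
  ultimately show ?thesis by simp
qed

definition scaled_proportion :: "nat \<Rightarrow> real" where
  "scaled_proportion n =
     (real (card (balanced_dyck_paths n)) / real (card (dyck_paths n))) / (2 / sqrt (pi * real n))"

lemma central_ratio_square: "central_ratio m ^ 2 = real ((2 * m) choose m) ^ 2 / 16 ^ m * (pi * real m)"
proof -
  have "(4 ^ m) ^ 2 = (16 :: real) ^ m"
    by (simp flip: power_mult_distrib add: power2_eq_square)
  then show ?thesis by (simp add: central_ratio_def power_mult_distrib power_divide)
qed

text \<open>
  Both the Narayana number (a product of two nearly central coefficients of row \<open>n\<close>) and the
  Catalan number are rational multiples of central binomial coefficients, with \<open>m = n div 2\<close> and
  with \<open>n\<close> itself respectively. Written with \<open>central_ratio\<close>, the powers of \<open>4\<close> cancel, the square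
  roots combine with \<open>2 / sqrt (\<pi> n)\<close>, and only a rational function of \<open>m\<close> tending to \<open>1\<close> remains.
  The shape of the nearly central coefficients depends on the parity of \<open>n\<close>.
\<close>

lemma scaled_proportion_even:
  assumes "m > 0"
  shows "scaled_proportion (2 * m) =
    central_ratio m ^ 2 / central_ratio (2 * m) * (real (2 * m + 1) / real (2 * m + 2))"
proof -
  define B where "B = real ((2 * m) choose m)"
  define D where "D = real ((2 * (2 * m)) choose (2 * m))"
  have pos: "B > 0" "D > 0" by (simp_all add: B_def D_def)
  have pred: "real ((2 * m) choose (m - 1)) = B * real m / real (m + 1)"
  proof -
    obtain i where m: "m = Suc i" using assms by (cases m) auto
    have "m * ((2 * m) choose m) = (m + 1) * ((2 * m) choose (m - 1))"
      using binomial_ratio[of i "2 * m"] unfolding m by simp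
    then have "real m * B = real (m + 1) * real ((2 * m) choose (m - 1))"
      unfolding B_def by (simp only: flip: of_nat_mult)
    then show ?thesis by (simp add: field_simps)
  qed
  have "real (card (balanced_dyck_paths (2 * m))) = B ^ 2 / (2 * real (m + 1))"
    using card_balanced_dyck_paths[of "2 * m"] assms pred
    by (simp add: narayana_def power2_eq_square flip: B_def)
  moreover have "real (card (dyck_paths (2 * m))) = D / real (2 * m + 1)"
    by (simp add: card_dyck_paths D_def)
  moreover define x where "x = sqrt (pi * real (2 * m))"
  ultimately have lhs: "scaled_proportion (2 * m) =
      B ^ 2 / (2 * real (m + 1)) / (D / real (2 * m + 1)) / (2 / x)"
    unfolding scaled_proportion_def by simp
  have x: "x > 0" "pi * real m = x ^ 2 / 2"
    using assms by (simp_all add: x_def)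
  have ratio: "central_ratio (2 * m) = D / 16 ^ m * x"
    by (simp add: central_ratio_def D_def x_def power_mult)
  have ratio_square: "central_ratio m ^ 2 = B ^ 2 / 16 ^ m * (x ^ 2 / 2)"
    unfolding B_def x(2)[symmetric] by (rule central_ratio_square)
  show ?thesis
    unfolding lhs ratio ratio_square using pos x(1)
    by (simp add: divide_simps power2_eq_square)
qed

lemma scaled_proportion_odd:
  assumes "m > 0"
  shows "scaled_proportion (2 * m + 1) =
    central_ratio m ^ 2 / central_ratio (2 * m + 1) * (real (2 * m + 1) ^ 2 / (4 * real m * real (m + 1)))"
proof -
  define B where "B = real ((2 * m) choose m)"
  define D where "D = real ((2 * (2 * m + 1)) choose (2 * m + 1))"
  define k where "k = real m"
  have pos: "B > 0" "D > 0" "k > 0" using assms by (simp_all add: B_def D_def k_def del: binomial_Suc_Suc)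
  have choose: "real ((2 * m + 1) choose m) = (2 * k + 1) * B / (k + 1)"
      "real ((2 * m + 1) choose (m + 1)) = (2 * k + 1) * B / (k + 1)"
    using odd_binomial_central[of m] pos(3)
    by (simp_all add: B_def k_def field_simps del: binomial_Suc_Suc)
  have "real (card (balanced_dyck_paths (2 * m + 1))) =
      1 / real (2 * m + 1) * real ((2 * m + 1) choose (m + 1)) * real ((2 * m + 1) choose m)"
    using card_balanced_dyck_paths[of "2 * m + 1"] by (simp add: narayana_def del: binomial_Suc_Suc)
  then have "real (card (balanced_dyck_paths (2 * m + 1))) =
      1 / (2 * k + 1) * ((2 * k + 1) * B / (k + 1)) * ((2 * k + 1) * B / (k + 1))"
    unfolding choose by (simp add: k_def add.commute)
  moreover have "real (card (dyck_paths (2 * m + 1))) = D / (2 * k + 2)"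
    unfolding card_dyck_paths D_def k_def by (simp add: add.commute)
  moreover define x where "x = sqrt (pi * real (2 * m + 1))"
  ultimately have "scaled_proportion (2 * m + 1) =
      1 / (2 * k + 1) * ((2 * k + 1) * B / (k + 1)) * ((2 * k + 1) * B / (k + 1)) / (D / (2 * k + 2)) / (2 / x)"
    unfolding scaled_proportion_def by simp
  also have "\<dots> = B ^ 2 * (2 * k + 1) * x / ((k + 1) * D)"
    using pos by (simp add: divide_simps power2_eq_square)
  finally have lhs: "scaled_proportion (2 * m + 1) = B ^ 2 * (2 * k + 1) * x / ((k + 1) * D)" .
  have x: "x > 0" "pi * (2 * k + 1) = x ^ 2"
    by (simp_all add: x_def k_def add_pos_nonneg algebra_simps)
  have ratio: "central_ratio (2 * m + 1) = D / (4 * 16 ^ m) * x"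
    by (simp add: central_ratio_def D_def x_def power_mult del: binomial_Suc_Suc)
  have ratio_square: "central_ratio m ^ 2 = B ^ 2 / 16 ^ m * (pi * k)"
    unfolding B_def k_def by (rule central_ratio_square)
  have "central_ratio m ^ 2 / central_ratio (2 * m + 1) * ((2 * k + 1) ^ 2 / (4 * k * (k + 1))) =
      B ^ 2 * (2 * k + 1) * (pi * (2 * k + 1)) / ((k + 1) * D * x)"
    unfolding ratio ratio_square using pos x(1) by (simp add: divide_simps power2_eq_square)
  also have "\<dots> = B ^ 2 * (2 * k + 1) * x / ((k + 1) * D)"
    unfolding x(2) using pos x(1) by (simp add: divide_simps power2_eq_square)
  finally show ?thesis unfolding lhs by (simp add: k_def add.commute)
qed

theorem theorem1:
  "(\<forall>n\<ge>1. real (card (balanced_dyck_paths n)) = narayana n (nat \<lceil>real n / 2\<rceil>)) \<and>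
   (\<lambda>n. (real (card (balanced_dyck_paths n)) / real (card (dyck_paths n))) / (2 / sqrt (pi * real n)))
     \<longlonglongrightarrow> 1"
proof (intro conjI allI impI)
  show "real (card (balanced_dyck_paths n)) = narayana n (nat \<lceil>real n / 2\<rceil>)" if "n \<ge> 1" for n
    using card_balanced_dyck_paths[OF that] by (simp only: nat_ceiling_half)
  have sub: "(\<lambda>m. central_ratio (2 * m)) \<longlonglongrightarrow> 1" "(\<lambda>m. central_ratio (2 * m + 1)) \<longlonglongrightarrow> 1"
    by (rule filterlim_compose[OF central_ratio_tendsto_1], real_asymp)+
  have "(\<lambda>m. real (2 * m + 1) / real (2 * m + 2)) \<longlonglongrightarrow> 1" by real_asymp
  then have "(\<lambda>m. central_ratio m ^ 2 / central_ratio (2 * m) * (real (2 * m + 1) / real (2 * m + 2)))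
      \<longlonglongrightarrow> 1 ^ 2 / 1 * 1"
    by (intro tendsto_intros central_ratio_tendsto_1 sub) auto
  moreover have "\<forall>\<^sub>F m in sequentially. scaled_proportion (2 * m) =
      central_ratio m ^ 2 / central_ratio (2 * m) * (real (2 * m + 1) / real (2 * m + 2))"
    using eventually_gt_at_top[of 0] by eventually_elim (rule scaled_proportion_even)
  ultimately have even: "(\<lambda>m. scaled_proportion (2 * m)) \<longlonglongrightarrow> 1"
    by (simp add: tendsto_cong)
  have "(\<lambda>m. real (2 * m + 1) ^ 2 / (4 * real m * real (m + 1))) \<longlonglongrightarrow> 1" by real_asymp
  then have "(\<lambda>m. central_ratio m ^ 2 / central_ratio (2 * m + 1) *
      (real (2 * m + 1) ^ 2 / (4 * real m * real (m + 1)))) \<longlonglongrightarrow> 1 ^ 2 / 1 * 1"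
    by (intro tendsto_intros central_ratio_tendsto_1 sub) auto
  moreover have "\<forall>\<^sub>F m in sequentially. scaled_proportion (2 * m + 1) =
      central_ratio m ^ 2 / central_ratio (2 * m + 1) * (real (2 * m + 1) ^ 2 / (4 * real m * real (m + 1)))"
    using eventually_gt_at_top[of 0] by eventually_elim (rule scaled_proportion_odd)
  ultimately have odd: "(\<lambda>m. scaled_proportion (2 * m + 1)) \<longlonglongrightarrow> 1"
    by (simp add: tendsto_cong)
  have "scaled_proportion \<longlonglongrightarrow> 1"
    by (rule limseq_even_odd[OF even odd])
  then show "(\<lambda>n. (real (card (balanced_dyck_paths n)) / real (card (dyck_paths n))) / (2 / sqrt (pi * real n)))
     \<longlonglongrightarrow> 1"
    unfolding scaled_proportion_def .
qed

end
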